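(* Let $\mathfrak{g}$ be the affine Kac--Moody algebra of type $A_2^{(2)}$, let $m\in\mathbb{Z}_{>0}$, and let $\Lambda=m\Lambda_0+\frac{j\alpha}2$ with $j\in[0,\frac m2]\cap\mathbb{Z}$. For each $k\in\frac12\mathbb{Z}$, let $\phi(m,j,k)$ be the number determined as follows: write $k=\frac m2q+r$ with $q\in\mathbb{Z}$ and $r\in[0,\frac m2)$, and set $$\phi(m,j,k)=-q(k+r+j)+\begin{cases}-r&\text{if }r\in[0,\frac m2-j],\\ \frac m2-j-2r&\text{if }r\in[\frac m2-j,\frac m2)\cap(\frac m2+\mathbb{Z}),\\ \frac{m-1}2-j-2r&\text{if }r\in[\frac{m-1}2-j,\frac m2)\cap(\frac{m-1}2+\mathbb{Z}).\end{cases}$$ Then $$\max(\Lambda)=\{\Lambda+k\alpha+\phi(m,j,k)\delta\mid k\in\tfrac12\mathbb{Z}\}.$$ Equivalently, for each $\lambda=m\Lambda_0+\frac{j'\alpha}2$ with $j'\in\mathbb{Z}$, we have $b_{\Lambda,\lambda}=\phi\bigl(m,j,\frac{j'-j}2\bigr)$.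
   Context: Type $A_2^{(2)}$: $\mathfrak{g}$ is the affine Kac--Moody algebra over $\mathbb{C}$ with Cartan matrix $(a_{ij})_{i,j\in\{0,1\}}=\begin{pmatrix}2&-4\\-1&2\end{pmatrix}$, Cartan subalgebra $\mathfrak{h}$ with basis $h_0,h_1,d$, simple roots $\alpha_0,\alpha_1$ with $\alpha_i(h_j)=a_{ji}$, $\alpha_0(d)=1$, $\alpha_1(d)=0$. Put $\alpha=\alpha_1$, $\delta=2\alpha_0+\alpha_1$; $\Lambda_0(h_0)=1$, $\Lambda_0(h_1)=\Lambda_0(d)=0$. For $\Lambda$ as in the claim, which is a dominant integral weight, $L(\Lambda)$ is the irreducible highest weight $\mathfrak{g}$-module of highest weight $\Lambda$ and $P(\Lambda)$ is its set of $\mathfrak{h}$-weights. $\max(\Lambda)$ is the set of maximal weights, i.e. of $\lambda\in P(\Lambda)$ such that $\lambda+n\delta\notin P(\Lambda)$ for all integers $n>0$. For $\lambda\in P(\Lambda)+\mathbb{C}\delta$, $b_{\Lambda,\lambda}\in\mathbb{C}$ is the unique number with $\lambda+b_{\Lambda,\lambda}\delta\in\max(\Lambda)$. On overlaps of the cases defining $\phi$ the formulas agree. *)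

theory Defs
  imports "HOL-Analysis.Analysis"
begin

section \<open>Complex Lie algebras and their modules\<close>

locale lie_algebra = vector_space scale
  for scale :: "complex \<Rightarrow> 'g::ab_group_add \<Rightarrow> 'g" +
  fixes bracket :: "'g \<Rightarrow> 'g \<Rightarrow> 'g"
  assumes bracket_linear_left: "Vector_Spaces.linear scale scale (\<lambda>x. bracket x y)"
    and bracket_linear_right: "Vector_Spaces.linear scale scale (\<lambda>y. bracket x y)"
    and bracket_self: "bracket x x = 0"
    and jacobi: "bracket x (bracket y z) + bracket y (bracket z x) + bracket z (bracket x y) = 0"
begin

definition lie_subalgebra :: "'g set \<Rightarrow> bool" where
  "lie_subalgebra S \<longleftrightarrow> subspace S \<and> (\<forall>x\<in>S. \<forall>y\<in>S. bracket x y \<in> S)"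

definition lie_ideal :: "'g set \<Rightarrow> bool" where
  "lie_ideal I \<longleftrightarrow> subspace I \<and> (\<forall>x. \<forall>y\<in>I. bracket x y \<in> I)"

end

locale lie_module = lie_algebra scale bracket + V: vector_space scaleV
  for scale :: "complex \<Rightarrow> 'g::ab_group_add \<Rightarrow> 'g"
    and bracket :: "'g \<Rightarrow> 'g \<Rightarrow> 'g"
    and scaleV :: "complex \<Rightarrow> 'v::ab_group_add \<Rightarrow> 'v" +
  fixes act :: "'g \<Rightarrow> 'v \<Rightarrow> 'v"
  assumes act_linear_left: "Vector_Spaces.linear scale scaleV (\<lambda>x. act x v)"
    and act_linear_right: "Vector_Spaces.linear scaleV scaleV (\<lambda>v. act x v)"
    and act_bracket: "act (bracket x y) v = act x (act y v) - act y (act x v)"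
begin

definition submodule :: "'v set \<Rightarrow> bool" where
  "submodule W \<longleftrightarrow> V.subspace W \<and> (\<forall>x. \<forall>w\<in>W. act x w \<in> W)"

definition irreducible_module :: bool where
  "irreducible_module \<longleftrightarrow>
     (UNIV :: 'v set) \<noteq> {0} \<and> (\<forall>W. submodule W \<longrightarrow> W = {0} \<or> W = UNIV)"

end

section \<open>The affine Kac--Moody algebra of type \<open>A\<^sub>2\<^sup>(\<^sup>2\<^sup>)\<close>\<close>

text \<open>The two-element type \<open>2\<close>, with elements \<open>0\<close> and \<open>1\<close>, is the index set of the Cartan matrix.\<close>

definition cartan :: "2 \<Rightarrow> 2 \<Rightarrow> int" where
  "cartan i j = (if i = j then 2 else if i = 0 then -4 else -1)"

text \<open>Labels for the basis \<open>h\<^sub>0, h\<^sub>1, d\<close> (in this order: \<open>Coroot 0, Coroot 1, Deriv\<close>)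
  of the Cartan subalgebra \<open>\<hh>\<close>.\<close>

datatype cartan_basis = Coroot "2" | Deriv

instance cartan_basis :: finite
proof
  have "(UNIV :: cartan_basis set) = insert Deriv (range Coroot)"
    by (auto intro: cartan_basis.exhaust)
  then show "finite (UNIV :: cartan_basis set)"
    by (metis finite finite_imageI finite_insert)
qed

text \<open>An element \<open>\<lambda>\<close> of the dual space of \<open>\<hh>\<close> is given by its values on the basis:
  \<open>\<lambda> $ Coroot i = \<lambda>(h\<^sub>i)\<close> and \<open>\<lambda> $ Deriv = \<lambda>(d)\<close>.  Multiplication by a complex
  scalar is \<open>(*s)\<close>.\<close>

type_synonym weight = "complex ^ cartan_basis"

definition simple_root :: "2 \<Rightarrow> weight" where
  "simple_root i = (\<chi> b. case b of Coroot j \<Rightarrow> of_int (cartan j i) | Deriv \<Rightarrow> if i = 0 then 1 else 0)"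

definition alpha :: weight where
  "alpha = simple_root 1"

definition delta :: weight where
  "delta = 2 *s simple_root 0 + simple_root 1"

definition Lambda0 :: weight where
  "Lambda0 = (\<chi> b. if b = Coroot 0 then 1 else 0)"

text \<open>The Kac--Moody algebra is taken in Kac's sense: it is generated by \<open>\<hh>\<close> and the Chevalley
  generators \<open>e\<^sub>i, f\<^sub>i\<close>, subject to the relations below, and no nonzero ideal meets \<open>\<hh>\<close> trivially
  (equivalently, it is the quotient of the algebra presented by these relations by its largest
  ideal meeting \<open>\<hh>\<close> trivially).  This determines it up to an isomorphism fixing the generators.\<close>

locale A22_algebra = lie_algebra scale bracket
  for scale :: "complex \<Rightarrow> 'g::ab_group_add \<Rightarrow> 'g"
    and bracket :: "'g \<Rightarrow> 'g \<Rightarrow> 'g" +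
  fixes h :: "cartan_basis \<Rightarrow> 'g"
    and e f :: "2 \<Rightarrow> 'g"
  assumes h_inj: "inj h"
    and h_independent: "independent (range h)"
    and h_h: "bracket (h b) (h c) = 0"
    and e_f: "bracket (e i) (f k) = (if i = k then h (Coroot i) else 0)"
    and h_e: "bracket (h b) (e i) = scale (simple_root i $ b) (e i)"
    and h_f: "bracket (h b) (f i) = scale (- (simple_root i $ b)) (f i)"
    and generated: "lie_subalgebra hull (range h \<union> range e \<union> range f) = UNIV"
    and no_ideals: "lie_ideal I \<Longrightarrow> I \<inter> span (range h) = {0} \<Longrightarrow> I = {0}"
begin

definition n_plus :: "'g set" where
  "n_plus = lie_subalgebra hull (range e)"

end

section \<open>Weights and irreducible highest weight modules\<close>

definition weight_space ::
  "(cartan_basis \<Rightarrow> 'g) \<Rightarrow> (complex \<Rightarrow> 'v \<Rightarrow> 'v) \<Rightarrow> ('g \<Rightarrow> 'v \<Rightarrow> 'v) \<Rightarrow> weight \<Rightarrow> 'v set" where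
  "weight_space h scaleV act \<mu> = {v. \<forall>b. act (h b) v = scaleV (\<mu> $ b) v}"

definition weights ::
  "(cartan_basis \<Rightarrow> 'g) \<Rightarrow> (complex \<Rightarrow> 'v::zero \<Rightarrow> 'v) \<Rightarrow> ('g \<Rightarrow> 'v \<Rightarrow> 'v) \<Rightarrow> weight set" where
  "weights h scaleV act = {\<mu>. \<exists>v \<in> weight_space h scaleV act \<mu>. v \<noteq> 0}"

definition max_weights ::
  "(cartan_basis \<Rightarrow> 'g) \<Rightarrow> (complex \<Rightarrow> 'v::zero \<Rightarrow> 'v) \<Rightarrow> ('g \<Rightarrow> 'v \<Rightarrow> 'v) \<Rightarrow> weight set" where
  "max_weights h scaleV act =
     {\<mu> \<in> weights h scaleV act. \<forall>n::int. n > 0 \<longrightarrow> \<mu> + of_int n *s delta \<notin> weights h scaleV act}"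

text \<open>The number \<open>b\<^bsub>\<Lambda>,\<lambda>\<^esub>\<close>, the unique \<open>b\<close> with \<open>\<lambda> + b\<delta> \<in> max(\<Lambda>)\<close>, is defined for \<open>\<lambda>\<close> in \<open>P(\<Lambda>) + \<complex>\<delta>\<close>.\<close>

definition max_shift ::
  "(cartan_basis \<Rightarrow> 'g) \<Rightarrow> (complex \<Rightarrow> 'v::zero \<Rightarrow> 'v) \<Rightarrow> ('g \<Rightarrow> 'v \<Rightarrow> 'v) \<Rightarrow> weight \<Rightarrow> complex" where
  "max_shift h scaleV act \<mu> = (THE b. \<mu> + b *s delta \<in> max_weights h scaleV act)"

locale A22_irreducible_highest_weight_module =
  A22_algebra scale bracket h e f + lie_module scale bracket scaleV act
  for scale :: "complex \<Rightarrow> 'g::ab_group_add \<Rightarrow> 'g"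
    and bracket :: "'g \<Rightarrow> 'g \<Rightarrow> 'g"
    and h :: "cartan_basis \<Rightarrow> 'g"
    and e f :: "2 \<Rightarrow> 'g"
    and scaleV :: "complex \<Rightarrow> 'v::ab_group_add \<Rightarrow> 'v"
    and act :: "'g \<Rightarrow> 'v \<Rightarrow> 'v" +
  fixes \<Lambda> :: weight
  assumes highest_weight_vector:
      "\<exists>v. v \<noteq> 0 \<and> v \<in> weight_space h scaleV act \<Lambda> \<and> (\<forall>x\<in>n_plus. act x v = 0) \<and>
           submodule hull {v} = UNIV"
    and irreducible: irreducible_module

section \<open>The function \<open>\<phi>\<close>\<close>

text \<open>For \<open>k\<close> in \<open>\<int>/2\<close>, \<open>0 < m\<close> and \<open>0 \<le> j \<le> m/2\<close> at least one of the three cases applies.\<close>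

definition phi :: "int \<Rightarrow> int \<Rightarrow> real \<Rightarrow> real" where
  "phi m j k =
     (let q = \<lfloor>k / (m / 2)\<rfloor>;
          r = k - m / 2 * q
      in - q * (k + r + j) +
         (if r \<in> {0 .. m / 2 - j} then - r
          else if r \<in> {m / 2 - j ..< m / 2} \<and> r - m / 2 \<in> \<int> then m / 2 - j - 2 * r
          else if r \<in> {(m - 1) / 2 - j ..< m / 2} \<and> r - (m - 1) / 2 \<in> \<int>
            then (m - 1) / 2 - j - 2 * r
          else undefined))"

end

theory Submission
  imports Defs
begin

text \<open>
  Integrability of \<open>L(\<Lambda>)\<close> makes its set of weights invariant under the simple reflections.
  Modulo the reflections, every \<open>k\<close> lies in the interval \<open>[-j/2, m/4 - j/2]\<close>, where \<open>\<Lambda> + k\<alpha> + b\<delta>\<close>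
  is dominant at the simple coroots.  There the largest \<open>b\<close> with \<open>\<Lambda> + k\<alpha> + b\<delta> \<in> \<Lambda> - Q\<^sub>+\<close> is \<open>-k\<close>, \<open>0\<close>
  or \<open>-1/2\<close>, and the weight is realised by a vector \<open>f\<^sub>0\<^sup>nv\<close>, \<open>f\<^sub>1\<^sup>nv\<close> or \<open>f\<^sub>0f\<^sub>1\<^sup>nv\<close>, nonzero by
  \<open>sl\<^sub>2\<close> theory.  The composite of the two reflections translates \<open>k\<close> by \<open>m/2\<close>, which is the
  division with remainder in the definition of \<open>\<phi>\<close>.
\<close>

section \<open>Weights and modules of the algebra\<close>

lemma index_cases: "i = 0 \<or> i = 1" for i :: 2
proof -
  have "(2::2) = 0" by simp
  then show ?thesis using exhaust_2[of i] by auto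
qed

lemma weight_eq_iff:
  "\<mu> = \<nu> \<longleftrightarrow> \<mu> $ Coroot 0 = \<nu> $ Coroot 0 \<and> \<mu> $ Coroot 1 = \<nu> $ Coroot 1 \<and> \<mu> $ Deriv = \<nu> $ Deriv"
  for \<mu> \<nu> :: weight
proof -
  have "(\<forall>b. \<mu> $ b = \<nu> $ b) \<longleftrightarrow> (\<forall>i. \<mu> $ Coroot i = \<nu> $ Coroot i) \<and> \<mu> $ Deriv = \<nu> $ Deriv"
    by (auto intro: cartan_basis.exhaust) (metis cartan_basis.exhaust)
  moreover have "(\<forall>i::2. P i) \<longleftrightarrow> P 0 \<and> P 1" for P
    using index_cases by metis
  ultimately show ?thesis by (simp add: vec_eq_iff)
qed

lemma simple_root_nth [simp]:
  "simple_root i $ Coroot k = of_int (cartan k i)"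
  "simple_root i $ Deriv = (if i = 0 then 1 else 0)"
  by (simp_all add: simple_root_def)

lemma cartan_simps [simp]:
  "cartan i i = 2" "cartan 0 1 = -4" "cartan 1 0 = -1"
  by (simp_all add: cartan_def)

section \<open>Integer coordinates on the root lattice\<close>

definition root_comb :: "int \<Rightarrow> int \<Rightarrow> weight" where
  "root_comb a b = of_int a *s simple_root 0 + of_int b *s simple_root 1"

lemma root_comb_nth [simp]:
  "root_comb a b $ Coroot 0 = of_int (2 * a - 4 * b)"
  "root_comb a b $ Coroot 1 = of_int (2 * b - a)"
  "root_comb a b $ Deriv = of_int a"
  by (simp_all add: root_comb_def)

text \<open>The Cartan matrix is singular, so the coroots alone do not separate the simple roots.
  The value on \<open>Deriv\<close> recovers \<open>a\<close>, and then the value on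
  \<open>Coroot 1\<close> recovers \<open>b\<close>.\<close>

lemma root_comb_inject [simp]: "root_comb a b = root_comb a' b' \<longleftrightarrow> a = a' \<and> b = b'"
  by (simp only: weight_eq_iff root_comb_nth of_int_eq_iff) linarith

lemma root_comb_zero [simp]: "root_comb 0 0 = 0"
  by (simp add: root_comb_def)

lemma root_comb_add: "root_comb a b + root_comb a' b' = root_comb (a + a') (b + b')"
  by (simp add: weight_eq_iff algebra_simps)

lemma root_comb_diff: "root_comb a b - root_comb a' b' = root_comb (a - a') (b - b')"
  by (simp add: weight_eq_iff algebra_simps)

lemma simple_root_mult_eq:
  "of_nat n *s simple_root i = root_comb (if i = 0 then int n else 0) (if i = 0 then 0 else int n)"
  using index_cases[of i] by (auto simp: root_comb_def)

lemma simple_root_eq: "simple_root i = root_comb (if i = 0 then 1 else 0) (if i = 0 then 0 else 1)"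
  using simple_root_mult_eq[of 1 i] by simp

text \<open>Each step moves \<open>E\<close> past one more \<open>F\<close> and adds the
  \<open>H\<close>-eigenvalue \<open>c - 2 * n\<close> of the current vector; the factor on the
  right is the sum of these. Keeping \<open>E\<close>, \<open>F\<close>, \<open>H\<close> abstract
  allows a later use with raising and lowering exchanged and \<open>H\<close> negated.\<close>

lemma (in vector_space) sl2_lowering_power:
  assumes EF: "\<And>x. E (F x) = F (E x) + H x"
    and HF: "\<And>x. H (F x) = F (H x) - scale 2 (F x)"
    and F_add: "\<And>x y. F (x + y) = F x + F y"
    and F_scale: "\<And>a x. F (scale a x) = scale a (F x)"
    and Eu: "E u = 0" and Hu: "H u = scale c u"
  shows "E ((F ^^ Suc n) u) = scale (of_nat (Suc n) * (c - of_nat n)) ((F ^^ n) u)"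
proof -
  have H: "H ((F ^^ n) u) = scale (c - 2 * of_nat n) ((F ^^ n) u)" for n
  proof (induction n)
    case (Suc n)
    have "H ((F ^^ Suc n) u) = scale (c - 2 * of_nat n) ((F ^^ Suc n) u) - scale 2 ((F ^^ Suc n) u)"
      by (simp add: HF Suc F_scale)
    also have "\<dots> = scale (c - 2 * of_nat (Suc n)) ((F ^^ Suc n) u)"
      unfolding scale_left_diff_distrib[symmetric] by (simp add: algebra_simps)
    finally show ?case .
  qed (simp add: Hu)
  have F0: "F 0 = 0" using F_scale[of 0 0] by simp
  show ?thesis
  proof (induction n)
    case 0
    then show ?case by (simp add: EF Eu F0 Hu)
  next
    case (Suc n)
    have "E ((F ^^ Suc (Suc n)) u) = F (E ((F ^^ Suc n) u)) + H ((F ^^ Suc n) u)"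
      by (simp add: EF)
    also have "\<dots> = scale (of_nat (Suc n) * (c - of_nat n)) ((F ^^ Suc n) u)
        + scale (c - 2 * of_nat (Suc n)) ((F ^^ Suc n) u)"
      by (simp only: Suc.IH F_scale H) simp
    also have "\<dots> = scale (of_nat (Suc (Suc n)) * (c - of_nat (Suc n))) ((F ^^ Suc n) u)"
      unfolding scale_left_distrib[symmetric] by (rule arg_cong2[where f = scale]) (simp_all add: algebra_simps)
    finally show ?case .
  qed
qed

section \<open>Calculus of brackets and actions\<close>

context lie_algebra
begin

lemma bracket_add_left: "bracket (x + y) z = bracket x z + bracket y z"
  and bracket_scale_left: "bracket (scale a x) z = scale a (bracket x z)"
  using bracket_linear_left by (simp_all add: Vector_Spaces.linear_iff)

lemma bracket_add_right: "bracket z (x + y) = bracket z x + bracket z y"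
  and bracket_scale_right: "bracket z (scale a x) = scale a (bracket z x)"
  using bracket_linear_right by (simp_all add: Vector_Spaces.linear_iff)

lemma bracket_zero_left [simp]: "bracket 0 x = 0"
  using bracket_scale_left[of 0 0 x] by simp

lemma bracket_zero_right [simp]: "bracket x 0 = 0"
  using bracket_scale_right[of x 0 0] by simp

lemma bracket_skew: "bracket x y = - bracket y x"
proof -
  have "bracket (x + y) (x + y) = bracket x y + bracket y x"
    by (subst bracket_add_left, subst (1 2) bracket_add_right) (simp add: bracket_self)
  then have "bracket x y + bracket y x = 0"
    by (metis bracket_self)
  then show ?thesis by (simp add: eq_neg_iff_add_eq_0)
qed

lemma bracket_minus_right: "bracket x (- y) = - bracket x y"
  using bracket_scale_right[of x "-1" y] by simp

text \<open>Makes every lemma on modules available for the algebra acting on itself; the Serre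
  relations are obtained this way.\<close>

lemma adjoint_lie_module: "lie_module scale bracket scale bracket"
proof (intro lie_module.intro lie_module_axioms.intro)
  show "lie_algebra scale bracket" "vector_space scale"
    by (rule lie_algebra_axioms vector_space_axioms)+
  show "Vector_Spaces.linear scale scale (\<lambda>x. bracket x v)" for v
    by (rule bracket_linear_left)
  show "Vector_Spaces.linear scale scale (bracket x)" for x
    by (rule bracket_linear_right)
  show "bracket (bracket x y) v = bracket x (bracket y v) - bracket y (bracket x v)" for x y v
    using jacobi[of x y v] bracket_skew[of v x] bracket_skew[of v "bracket x y"]
    by (simp add: bracket_minus_right algebra_simps eq_neg_iff_add_eq_0)
qed

end

context lie_module
begin

lemma act_add_left: "act (x + y) v = act x v + act y v"
  and act_scale_left: "act (scale a x) v = scaleV a (act x v)"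
  using act_linear_left by (simp_all add: Vector_Spaces.linear_iff)

lemma act_minus_left: "act (- x) v = - act x v"
  using act_scale_left[of "-1" x v] by simp

lemma act_add_right: "act x (v + w) = act x v + act x w"
  and act_scale_right: "act x (scaleV a v) = scaleV a (act x v)"
  using act_linear_right by (simp_all add: Vector_Spaces.linear_iff)

lemma act_zero_left [simp]: "act 0 v = 0"
  using act_scale_left[of 0 0 v] by simp

lemma act_zero_right [simp]: "act x 0 = 0"
  using act_scale_right[of x 0 0] by simp

lemma act_minus_right: "act x (- v) = - act x v"
  using act_scale_right[of x "-1" v] by simp

lemma act_sum_right: "act x (\<Sum>i\<in>F. g i) = (\<Sum>i\<in>F. act x (g i))"
  by (induction F rule: infinite_finite_induct) (simp_all add: act_add_right)

lemma act_act: "act x (act y v) = act (bracket x y) v + act y (act x v)"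
  by (simp add: act_bracket)

lemma act_pow_zero [simp]: "(act x ^^ n) 0 = 0"
  by (induction n) simp_all

lemma act_pow_add: "(act x ^^ n) (v + w) = (act x ^^ n) v + (act x ^^ n) w"
  by (induction n) (simp_all add: act_add_right)

lemma act_pow_scale: "(act x ^^ n) (scaleV a v) = scaleV a ((act x ^^ n) v)"
  by (induction n) (simp_all add: act_scale_right)

lemma act_pow_zero_mono: "(act x ^^ n) v = 0 \<Longrightarrow> n \<le> p \<Longrightarrow> (act x ^^ p) v = 0"
  by (metis act_pow_zero comp_apply funpow_add le_add_diff_inverse2)

lemma act_span:
  assumes "\<And>y. y \<in> D \<Longrightarrow> act x y \<in> V.span D" and "w \<in> V.span D"
  shows "act x w \<in> V.span D"
  using assms(2)
proof (induction rule: V.span_induct_alt)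
  case (step c y z)
  then show ?case
    by (simp add: act_add_right act_scale_right V.span_add V.span_scale assms(1))
qed (simp add: V.span_zero)

text \<open>This is the Leibniz rule: in the expansion of \<open>n + p\<close> applications of
  \<open>x\<close> to \<open>act y v\<close>, each term has at least \<open>p\<close> of them
  bracketed into \<open>y\<close> or at least \<open>n\<close> of them reaching \<open>v\<close>.
  The induction replaces the binomial sum by one splitting at a time, which lowers \<open>p\<close>
  or \<open>n\<close> by one.\<close>

lemma act_pow_act_eq_0:
  assumes "(bracket x ^^ p) y = 0" and "(act x ^^ n) v = 0"
  shows "(act x ^^ (n + p)) (act y v) = 0"
  using assms
proof (induction "n + p" arbitrary: n p y v)
  case (Suc N)
  show ?case
  proof (cases "n = 0 \<or> p = 0")
    case True
    then show ?thesis using Suc.prems by auto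
  next
    case False
    then obtain n' p' where np: "n = Suc n'" "p = Suc p'"
      by (meson not0_implies_Suc)
    have "(act x ^^ (n + p')) (act (bracket x y) v) = 0"
      using Suc.hyps(2) Suc.prems by (intro Suc.hyps(1)) (simp_all add: np funpow_Suc_right del: funpow.simps)
    moreover have "(act x ^^ (n' + p)) (act y (act x v)) = 0"
      using Suc.hyps(2) Suc.prems by (intro Suc.hyps(1)) (simp_all add: np funpow_Suc_right del: funpow.simps)
    moreover have "(act x ^^ Suc N) (act y v) =
        (act x ^^ N) (act (bracket x y) v) + (act x ^^ N) (act y (act x v))"
      by (simp only: funpow_Suc_right comp_apply act_act[of x y v] act_pow_add)
    moreover have "n + p' = N" "n' + p = N" using Suc.hyps(2) np by auto
    ultimately show ?thesis using Suc.hyps(2) by simp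
  qed
qed auto

end

section \<open>Weight spaces, singular vectors and root strings\<close>

locale A22_module = A22_algebra scale bracket h e f + lie_module scale bracket scaleV act
  for scale :: "complex \<Rightarrow> 'g::ab_group_add \<Rightarrow> 'g"
    and bracket :: "'g \<Rightarrow> 'g \<Rightarrow> 'g"
    and h :: "cartan_basis \<Rightarrow> 'g"
    and e f :: "2 \<Rightarrow> 'g"
    and scaleV :: "complex \<Rightarrow> 'v::ab_group_add \<Rightarrow> 'v"
    and act :: "'g \<Rightarrow> 'v \<Rightarrow> 'v"
begin

abbreviation wspace :: "weight \<Rightarrow> 'v set" where
  "wspace \<equiv> weight_space h scaleV act"

lemma h_wspace: "v \<in> wspace \<mu> \<Longrightarrow> act (h b) v = scaleV (\<mu> $ b) v"
  by (simp add: weight_space_def)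

lemma wspace_zero: "0 \<in> wspace \<mu>"
  by (simp add: weight_space_def)

lemma wspace_add: "v \<in> wspace \<mu> \<Longrightarrow> w \<in> wspace \<mu> \<Longrightarrow> v + w \<in> wspace \<mu>"
  by (simp add: weight_space_def act_add_right V.scale_right_distrib)

lemma wspace_scale: "v \<in> wspace \<mu> \<Longrightarrow> scaleV a v \<in> wspace \<mu>"
  by (simp add: weight_space_def act_scale_right mult.commute)

lemma e_wspace: "v \<in> wspace \<mu> \<Longrightarrow> act (e i) v \<in> wspace (\<mu> + simple_root i)"
  by (simp add: weight_space_def act_act[of "h _" "e i"] h_e act_scale_left act_scale_right
      V.scale_left_distrib add.commute)

lemma f_wspace: "v \<in> wspace \<mu> \<Longrightarrow> act (f i) v \<in> wspace (\<mu> - simple_root i)"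
  by (simp add: weight_space_def act_act[of "h _" "f i"] h_f act_scale_left act_scale_right
      act_minus_left V.scale_left_diff_distrib del: simple_root_nth)

lemma e_pow_wspace: "v \<in> wspace \<mu> \<Longrightarrow> (act (e i) ^^ n) v \<in> wspace (\<mu> + of_nat n *s simple_root i)"
proof (induction n)
  case (Suc n)
  then have "act (e i) ((act (e i) ^^ n) v) \<in> wspace (\<mu> + of_nat n *s simple_root i + simple_root i)"
    by (intro e_wspace) simp
  then show ?case by (simp add: vector_sadd_rdistrib algebra_simps)
qed simp

lemma f_pow_wspace: "v \<in> wspace \<mu> \<Longrightarrow> (act (f i) ^^ n) v \<in> wspace (\<mu> - of_nat n *s simple_root i)"
proof (induction n)
  case (Suc n)
  then have "act (f i) ((act (f i) ^^ n) v) \<in> wspace (\<mu> - of_nat n *s simple_root i - simple_root i)"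
    by (intro f_wspace) simp
  then show ?case by (simp add: vector_sadd_rdistrib algebra_simps)
qed simp

lemma weight_vectors_independent:
  assumes "finite F" and "\<And>\<nu>. \<nu> \<in> F \<Longrightarrow> u \<nu> \<in> wspace \<nu>"
    and "(\<Sum>\<nu>\<in>F. u \<nu>) = 0" and "\<nu> \<in> F"
  shows "u \<nu> = 0"
  using assms
proof (induction F arbitrary: u \<nu> rule: finite_induct)
  case (insert \<kappa> F)
  have *: "u \<nu> = 0" if "\<nu> \<in> F" for \<nu>
  proof -
    have "\<nu> \<noteq> \<kappa>" using that insert.hyps by blast
    then obtain b where b: "\<nu> $ b \<noteq> \<kappa> $ b" by (auto simp: vec_eq_iff)
    have hu: "act (h b) (u \<nu>) = scaleV (\<nu> $ b) (u \<nu>)" if "\<nu> \<in> insert \<kappa> F" for \<nu>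
      using insert.prems(1)[OF that] by (rule h_wspace)
    have sum: "u \<kappa> + (\<Sum>\<nu>\<in>F. u \<nu>) = 0"
      using insert.prems insert.hyps by simp
    \<comment> \<open>Applying \<open>h b\<close> minus the scalar \<open>\<kappa> $ b\<close> to
      the relation kills the term at \<kappa> and rescales the others, leaving a relation over the
      smaller set. The factor at the chosen \<nu> is nonzero by the choice of
      \<open>b\<close>.\<close>
    have "(\<Sum>\<nu>\<in>F. scaleV (\<nu> $ b - \<kappa> $ b) (u \<nu>)) = (\<Sum>\<nu>\<in>F. act (h b) (u \<nu>)) - scaleV (\<kappa> $ b) (\<Sum>\<nu>\<in>F. u \<nu>)"
      by (simp add: V.scale_left_diff_distrib sum_subtractf V.scale_sum_right hu cong: sum.cong)
    also have "\<dots> = act (h b) (u \<kappa> + (\<Sum>\<nu>\<in>F. u \<nu>)) - scaleV (\<kappa> $ b) (u \<kappa> + (\<Sum>\<nu>\<in>F. u \<nu>))"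
      by (simp add: act_add_right act_sum_right hu V.scale_right_distrib)
    also have "\<dots> = 0" by (simp add: sum)
    finally have "scaleV (\<nu> $ b - \<kappa> $ b) (u \<nu>) = 0"
      using insert.prems(1) that
      by (intro insert.IH[where u = "\<lambda>\<nu>. scaleV (\<nu> $ b - \<kappa> $ b) (u \<nu>)"]) (auto intro: wspace_scale)
    with b show ?thesis by simp
  qed
  then have "(\<Sum>\<nu>\<in>F. u \<nu>) = 0" by simp
  then have "u \<kappa> = 0" using insert.prems insert.hyps by simp
  with * insert.prems show ?case by auto
qed simp

text \<open>Such a \<open>w\<close> is a finite sum of weight vectors with weights in
  \<open>A\<close>. If \<mu> were outside \<open>A\<close>, moving \<open>w\<close> to the other
  side would give a dependence between vectors of distinct weights.\<close>

lemma weight_mem_of_span: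
  assumes D: "D \<subseteq> (\<Union>\<nu>\<in>A. wspace \<nu>)" and w: "w \<in> V.span D" "w \<in> wspace \<mu>" "w \<noteq> 0"
  shows "\<mu> \<in> A"
proof (rule ccontr)
  assume "\<mu> \<notin> A"
  have "\<exists>F u. finite F \<and> F \<subseteq> A \<and> (\<forall>\<nu>\<in>F. u \<nu> \<in> wspace \<nu>) \<and> w = (\<Sum>\<nu>\<in>F. u \<nu>)"
    using w(1)
  proof (induction rule: V.span_induct_alt)
    case base
    show ?case by (intro exI[of _ "{}"]) simp
  next
    case (step c x y)
    then obtain F u where F: "finite F" "F \<subseteq> A" "\<forall>\<nu>\<in>F. u \<nu> \<in> wspace \<nu>" "y = (\<Sum>\<nu>\<in>F. u \<nu>)"
      by blast
    obtain \<kappa> where \<kappa>: "\<kappa> \<in> A" "x \<in> wspace \<kappa>" using D step by blast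
    \<comment> \<open>The weight \<kappa> may already occur in \<open>F\<close>, so the new term is
      added to the component there instead of replacing it.\<close>
    let ?u = "\<lambda>\<nu>. (if \<nu> \<in> F then u \<nu> else 0) + (if \<nu> = \<kappa> then scaleV c x else 0)"
    have "(\<Sum>\<nu>\<in>insert \<kappa> F. ?u \<nu>) = scaleV c x + y"
      using F(1) by (simp add: sum.distrib F(4) sum.inter_restrict[symmetric] Int_absorb1 subset_insertI
          if_distrib[of "\<lambda>x. x + _"] sum.insert_if)
    moreover have "?u \<nu> \<in> wspace \<nu>" if "\<nu> \<in> insert \<kappa> F" for \<nu>
      using that F(3) \<kappa>(2) by (auto intro!: wspace_add wspace_scale simp: wspace_zero)
    ultimately show ?case
      using F(1,2) \<kappa>(1) by (intro exI[of _ "insert \<kappa> F"] exI[of _ ?u]) auto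
  qed
  then obtain F u where F: "finite F" "F \<subseteq> A" "\<forall>\<nu>\<in>F. u \<nu> \<in> wspace \<nu>" "w = (\<Sum>\<nu>\<in>F. u \<nu>)"
    by blast
  let ?u = "u(\<mu> := scaleV (-1) w)"
  have "\<mu> \<notin> F" using F \<open>\<mu> \<notin> A\<close> by blast
  then have eq: "(\<Sum>\<nu>\<in>F. ?u \<nu>) = (\<Sum>\<nu>\<in>F. u \<nu>)"
    by (intro sum.cong) auto
  have "?u \<mu> = 0"
  proof (rule weight_vectors_independent[where u = ?u and F = "insert \<mu> F"])
    show "(\<Sum>\<nu>\<in>insert \<mu> F. ?u \<nu>) = 0"
      using F(1) \<open>\<mu> \<notin> F\<close> eq F(4) by (simp del: fun_upd_apply) simp
    show "\<And>\<nu>. \<nu> \<in> insert \<mu> F \<Longrightarrow> ?u \<nu> \<in> wspace \<nu>"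
      using F(3) wspace_scale[OF w(2), of "-1"] by auto
  qed (use F in auto)
  with w(3) show False by simp
qed

text \<open>The elements of the algebra that preserve \<open>W\<close> form a Lie subalgebra; once
  it contains the generators it is everything.\<close>

lemma submodule_of_generators:
  assumes W: "V.subspace W"
    and "\<And>b w. w \<in> W \<Longrightarrow> act (h b) w \<in> W"
    and "\<And>i w. w \<in> W \<Longrightarrow> act (e i) w \<in> W"
    and "\<And>i w. w \<in> W \<Longrightarrow> act (f i) w \<in> W"
  shows "submodule W"
proof -
  let ?S = "{x. \<forall>w\<in>W. act x w \<in> W}"
  have "lie_subalgebra ?S"
    using W by (auto simp: lie_subalgebra_def subspace_def V.subspace_def act_add_left
        act_scale_left act_bracket intro: V.subspace_diff[OF W])
  moreover have "range h \<union> range e \<union> range f \<subseteq> ?S" using assms by auto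
  ultimately have "lie_subalgebra hull (range h \<union> range e \<union> range f) \<subseteq> ?S"
    by (intro hull_minimal)
  then show ?thesis using W by (auto simp: generated submodule_def)
qed

text \<open>The span of this set plays the role of U(n_-)u without introducing the enveloping
  algebra.\<close>

inductive_set lowered :: "'v \<Rightarrow> 'v set" for u :: 'v where
  lowered_self: "u \<in> lowered u"
| lowered_f: "y \<in> lowered u \<Longrightarrow> act (f i) y \<in> lowered u"

lemma lowered_weight:
  assumes "u \<in> wspace \<mu>" and "y \<in> lowered u"
  shows "\<exists>a b. 0 \<le> a \<and> 0 \<le> b \<and> y \<in> wspace (\<mu> - root_comb a b)"
  using assms(2)
proof induction
  case lowered_self
  show ?case using assms(1) by (intro exI[of _ 0]) simp
next
  case (lowered_f y i)
  then obtain a b where ab: "0 \<le> a" "0 \<le> b" "y \<in> wspace (\<mu> - root_comb a b)" by blast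
  from f_wspace[OF ab(3), of i] show ?case
    using ab(1,2) unfolding simple_root_eq diff_diff_eq root_comb_add
    by (intro exI[of _ "a + (if i = 0 then 1 else 0)"] exI[of _ "b + (if i = 0 then 0 else 1)"]) auto
qed

text \<open>Moving \<open>e i\<close> to the right past an \<open>f k\<close> leaves either nothing
  or the action of \<open>h (Coroot i)\<close>, which only rescales a weight vector; at the end
  \<open>e i\<close> meets \<open>u\<close> and gives 0.\<close>

lemma submodule_span_lowered:
  assumes u: "u \<in> wspace \<mu>" and eu: "\<And>i. act (e i) u = 0"
  shows "submodule (V.span (lowered u))"
proof -
  let ?W = "V.span (lowered u)"
  have h: "act (h b) y \<in> ?W" if "y \<in> lowered u" for b y
    using lowered_weight[OF u that] that by (metis h_wspace V.span_scale V.span_base)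
  have f: "act (f i) w \<in> ?W" if "w \<in> ?W" for i w
    by (rule act_span[OF _ that]) (auto intro: V.span_base lowered_f)
  have e: "act (e i) y \<in> ?W" if "y \<in> lowered u" for i y
    using that
  proof induction
    case lowered_self
    then show ?case by (simp add: eu V.span_zero)
  next
    case (lowered_f y k)
    then show ?case
      using h[OF lowered_f(1)] f[OF lowered_f(2)]
      by (auto simp: act_act[of "e i"] e_f intro: V.span_add)
  qed
  show ?thesis
    by (intro submodule_of_generators V.subspace_span f act_span[OF h] act_span[OF e])
qed

lemma weight_of_span_lowered:
  assumes "u \<in> wspace \<mu>" and "w \<in> V.span (lowered u)" "w \<in> wspace \<nu>" "w \<noteq> 0"
  shows "\<exists>a b. 0 \<le> a \<and> 0 \<le> b \<and> \<nu> = \<mu> - root_comb a b"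
proof -
  have "\<nu> \<in> {\<mu> - root_comb a b | a b. 0 \<le> a \<and> 0 \<le> b}"
    by (rule weight_mem_of_span[OF _ assms(2-4)]) (use lowered_weight[OF assms(1)] in blast)
  then show ?thesis by blast
qed

lemma e_f_pow:
  assumes "u \<in> wspace \<mu>" and "act (e i) u = 0"
  shows "act (e i) ((act (f i) ^^ Suc n) u) =
    scaleV (of_nat (Suc n) * (\<mu> $ Coroot i - of_nat n)) ((act (f i) ^^ n) u)"
  by (rule V.sl2_lowering_power[where H = "act (h (Coroot i))"])
    (simp_all add: act_act[of "e i" "f i"] act_act[of "h _" "f i"] e_f h_f act_scale_left act_add_right
      act_minus_left act_scale_right assms h_wspace[OF assms(1)])

text \<open>Exchanging \<open>e i\<close> and \<open>f i\<close> turns the coroot into its negative,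
  hence the sign of \<open>\<mu> $ Coroot i\<close>.\<close>

lemma f_e_pow:
  assumes "u \<in> wspace \<mu>" and "act (f i) u = 0"
  shows "act (f i) ((act (e i) ^^ Suc n) u) =
    scaleV (of_nat (Suc n) * (- (\<mu> $ Coroot i) - of_nat n)) ((act (e i) ^^ n) u)"
  by (rule V.sl2_lowering_power[where H = "\<lambda>x. - act (h (Coroot i)) x"])
    (simp_all add: act_act[of "e i" "f i"] act_act[of "h _" "e i"] e_f h_e act_scale_left act_add_right
      act_minus_left act_minus_right act_scale_right assms h_wspace[OF assms(1)])

text \<open>For \<open>n < c\<close> the factor
  \<open>of_nat (Suc n) * (of_nat c - of_nat n)\<close> is nonzero, so \<open>e i\<close> maps the
  next power to a nonzero multiple of the previous one.\<close>

lemma f_pow_neq_0: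
  assumes "u \<in> wspace \<mu>" "act (e i) u = 0" "u \<noteq> 0" "\<mu> $ Coroot i = of_nat c" "n \<le> c"
  shows "(act (f i) ^^ n) u \<noteq> 0"
  using assms(5)
proof (induction n)
  case (Suc n)
  have "act (e i) ((act (f i) ^^ Suc n) u) \<noteq> 0"
    using Suc assms(4) unfolding e_f_pow[OF assms(1,2)] by (auto simp del: of_nat_Suc)
  then show ?case by auto
qed (simp add: assms)

lemma e_pow_neq_0:
  assumes "u \<in> wspace \<mu>" "act (f i) u = 0" "u \<noteq> 0" "\<mu> $ Coroot i = - of_nat c" "n \<le> c"
  shows "(act (e i) ^^ n) u \<noteq> 0"
  using assms(5)
proof (induction n)
  case (Suc n)
  have "act (f i) ((act (e i) ^^ Suc n) u) \<noteq> 0"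
    using Suc assms(4) unfolding f_e_pow[OF assms(1,2)] by (auto simp del: of_nat_Suc)
  then show ?case by auto
qed (simp add: assms)

lemma e_f_pow_other:
  assumes "i \<noteq> k"
  shows "act (e k) ((act (f i) ^^ n) u) = (act (f i) ^^ n) (act (e k) u)"
  by (induction n) (use assms in \<open>simp_all add: act_act[of "e k"] e_f\<close>)

end

section \<open>The Serre relations for the lowering generators\<close>

context A22_algebra
begin

lemma adjoint_A22_module: "A22_module scale bracket h e f scale bracket"
  by (intro A22_module.intro adjoint_lie_module) (rule A22_algebra_axioms)

text \<open>The Serre element is singular in the adjoint module, so the ideal it generates has only
  weights below 0 and does not meet the Cartan subalgebra.\<close>

lemma serre_f:
  assumes "i \<noteq> k"
  shows "(bracket (f i) ^^ nat (1 - cartan i k)) (f k) = 0"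
proof -
  interpret adj: A22_module scale bracket h e f scale bracket by (rule adjoint_A22_module)
  define c where "c = nat (- cartan i k)"
  have c: "cartan i k = - int c" "c \<ge> 1" "nat (1 - cartan i k) = Suc c"
    using assms by (auto simp: c_def cartan_def)
  define x where "x = (bracket (f i) ^^ Suc c) (f k)"
  have fk: "f k \<in> adj.wspace (- simple_root k)"
    by (simp add: weight_space_def h_f del: simple_root_nth)
  define \<mu> where "\<mu> = - simple_root k - of_nat (Suc c) *s simple_root i"
  have x\<mu>: "x \<in> adj.wspace \<mu>"
    unfolding x_def \<mu>_def by (rule adj.f_pow_wspace[OF fk])
  \<comment> \<open>The vector \<open>f k\<close> is killed by \<open>e i\<close> and has
    \<open>h (Coroot i)\<close>-eigenvalue \<open>c\<close>, so the last factor of the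
    \<open>sl_2\<close> formula is \<open>c - c\<close>.\<close>
  have "bracket (e i) x = 0"
    unfolding x_def using assms adj.e_f_pow[OF fk, of i c] by (simp add: e_f c(1))
  moreover have "bracket (e k) x = 0"
  proof -
    \<comment> \<open>Moving \<open>e k\<close> through the powers of \<open>f i\<close> turns
      \<open>f k\<close> into \<open>h (Coroot k)\<close>. Two brackets with \<open>f i\<close> kill
      that, and \<open>Suc c\<close> is at least 2.\<close>
    have "bracket (f i) (h (Coroot k)) = scale (simple_root i $ Coroot k) (f i)"
      by (subst bracket_skew) (simp add: h_f del: simple_root_nth)
    then have "(bracket (f i) ^^ 2) (h (Coroot k)) = 0"
      by (simp add: numeral_2_eq_2 bracket_scale_right bracket_self)
    then have "(bracket (f i) ^^ Suc c) (h (Coroot k)) = 0"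
      by (rule adj.act_pow_zero_mono) (use c(2) in simp)
    then show ?thesis
      unfolding x_def adj.e_f_pow_other[OF assms] by (simp add: e_f)
  qed
  ultimately have ex: "bracket (e l) x = 0" for l
    using assms index_cases[of i] index_cases[of k] index_cases[of l] by auto
  let ?I = "span (adj.lowered x)"
  have "lie_ideal ?I"
    using adj.submodule_span_lowered[OF x\<mu> ex] by (simp add: adj.submodule_def lie_ideal_def)
  moreover have "?I \<inter> span (range h) = {0}"
  proof -
    have "y = 0" if y: "y \<in> ?I" "y \<in> span (range h)" for y
    proof (rule ccontr)
      assume "y \<noteq> 0"
      have "h b \<in> adj.wspace 0" for b
        by (simp add: weight_space_def h_h)
      with y(2) have "y \<in> adj.wspace 0"
        by (induction rule: span_induct_alt)
          (auto intro!: adj.wspace_add adj.wspace_scale adj.wspace_zero)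
      from adj.weight_of_span_lowered[OF x\<mu> y(1) this \<open>y \<noteq> 0\<close>]
      obtain a b where ab: "0 \<le> a" "0 \<le> b" "0 = \<mu> - root_comb a b" by blast
      \<comment> \<open>Both coefficients of \<mu> are negative, while weight 0 below \<mu> would
        require \<open>root_comb a b\<close> to equal \<mu> with nonnegative \<open>a\<close> and
        \<open>b\<close>.\<close>
      have "\<mu> = root_comb 0 0 - root_comb (if k = 0 then 1 else 0) (if k = 0 then 0 else 1)
          - root_comb (if i = 0 then int (Suc c) else 0) (if i = 0 then 0 else int (Suc c))"
        unfolding \<mu>_def simple_root_mult_eq by (simp add: simple_root_eq[symmetric])
      with ab(3) have "root_comb a b = root_comb 0 0 - root_comb (if k = 0 then 1 else 0) (if k = 0 then 0 else 1)
          - root_comb (if i = 0 then int (Suc c) else 0) (if i = 0 then 0 else int (Suc c))" by simp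
      with ab(1,2) show False
        unfolding root_comb_diff root_comb_inject by (auto split: if_splits)
    qed
    then show ?thesis by (auto simp: span_zero)
  qed
  ultimately have "?I = {0}" by (rule no_ideals)
  then have "x = 0" using span_base[OF adj.lowered_self] by blast
  then show ?thesis by (simp only: x_def c(3))
qed

end

section \<open>Irreducible highest weight modules\<close>

text \<open>Supplies the extreme vector of a root string, at which \<open>sl_2\<close> theory can
  start.\<close>

lemma funpow_last_nonzero:
  fixes T :: "'a::zero \<Rightarrow> 'a"
  assumes "u \<noteq> 0" and "(T ^^ n) u = 0"
  obtains p where "(T ^^ p) u \<noteq> 0" and "(T ^^ Suc p) u = 0"
proof -
  define l where "l = (LEAST n. (T ^^ n) u = 0)"
  have "(T ^^ l) u = 0" unfolding l_def by (rule LeastI[where P = "\<lambda>n. (T ^^ n) u = 0", OF assms(2)])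
  moreover from this obtain p where "l = Suc p" using assms(1) by (cases l) auto
  moreover from this have "(T ^^ p) u \<noteq> 0" unfolding l_def by (intro not_less_Least) simp
  ultimately show ?thesis using that by blast
qed

sublocale A22_irreducible_highest_weight_module \<subseteq> A22_module ..

context A22_irreducible_highest_weight_module
begin

lemma span_lowered_eq_UNIV:
  assumes "u \<in> wspace \<mu>" "u \<noteq> 0" "\<And>i. act (e i) u = 0"
  shows "V.span (lowered u) = UNIV"
proof -
  have "submodule (V.span (lowered u))" by (rule submodule_span_lowered[OF assms(1,3)])
  moreover have "u \<in> V.span (lowered u)" by (intro V.span_base lowered_self)
  ultimately show ?thesis
    using irreducible assms(2) unfolding irreducible_module_def by blast
qed

lemma highest_weight_vectorE:
  obtains v where "v \<noteq> 0" "v \<in> wspace \<Lambda>" "\<And>i. act (e i) v = 0"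
proof -
  obtain v where v: "v \<noteq> 0" "v \<in> wspace \<Lambda>" "\<forall>x\<in>n_plus. act x v = 0"
    using highest_weight_vector by blast
  have "e i \<in> n_plus" for i
    unfolding n_plus_def by (rule hull_inc) simp
  with v that show ?thesis by blast
qed

lemma weights_below:
  assumes "\<mu> \<in> weights h scaleV act"
  obtains a b where "0 \<le> a" "0 \<le> b" "\<mu> = \<Lambda> - root_comb a b"
proof -
  obtain v where v: "v \<noteq> 0" "v \<in> wspace \<Lambda>" "\<And>i. act (e i) v = 0"
    using highest_weight_vectorE by blast
  obtain u where u: "u \<in> wspace \<mu>" "u \<noteq> 0"
    using assms by (auto simp: weights_def)
  show ?thesis
    using weight_of_span_lowered[OF v(2) _ u] span_lowered_eq_UNIV[OF v(2,1,3)] that by blast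
qed

text \<open>By irreducibility, \<open>u\<close> and the highest weight vector each generate the
  whole module by lowering. So \<mu> and \<Lambda> lie below each other, and nonnegative
  coefficients that sum to 0 vanish.\<close>

lemma singular_vector_weight:
  assumes u: "u \<in> wspace \<mu>" "u \<noteq> 0" "\<And>i. act (e i) u = 0"
  shows "\<mu> = \<Lambda>"
proof -
  obtain v where v: "v \<noteq> 0" "v \<in> wspace \<Lambda>" "\<And>i. act (e i) v = 0"
    using highest_weight_vectorE by blast
  obtain a b where ab: "0 \<le> a" "0 \<le> b" "\<mu> = \<Lambda> - root_comb a b"
  proof (rule weights_below)
    show "\<mu> \<in> weights h scaleV act" using u(1,2) by (auto simp: weights_def)
  qed
  obtain a' b' where ab': "0 \<le> a'" "0 \<le> b'" "\<Lambda> = \<mu> - root_comb a' b'"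
    using weight_of_span_lowered[OF u(1) _ v(2,1)] span_lowered_eq_UNIV[OF u] by blast
  from ab(3) ab'(3) have "root_comb a b + root_comb a' b' = 0"
    by (simp add: algebra_simps)
  then have "root_comb (a + a') (b + b') = root_comb 0 0"
    by (simp add: root_comb_add)
  then have "a = 0" "b = 0"
    using ab(1,2) ab'(1,2) unfolding root_comb_inject by auto
  then show ?thesis using ab(3) by simp
qed

section \<open>Integrability and invariance under the simple reflections\<close>

lemma e_locally_nilpotent:
  assumes "u \<in> wspace \<mu>"
  shows "\<exists>n. (act (e i) ^^ n) u = 0"
proof (rule ccontr)
  assume *: "\<nexists>n. (act (e i) ^^ n) u = 0"
  then have "u \<noteq> 0" by (metis funpow_0)
  with assms have "\<mu> \<in> weights h scaleV act" by (auto simp: weights_def)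
  then obtain a b where \<mu>: "\<mu> = \<Lambda> - root_comb a b"
    by (rule weights_below)
  \<comment> \<open>Raising this often makes the coefficient of the simple root negative, whichever
    of \<open>a\<close> and \<open>b\<close> belongs to it.\<close>
  define n where "n = nat (max a b) + 1"
  have "\<mu> + of_nat n *s simple_root i \<in> weights h scaleV act"
    using e_pow_wspace[OF assms, where i = i and n = n] * by (auto simp: weights_def)
  then obtain a' b' where ab': "0 \<le> a'" "0 \<le> b'" "\<mu> + of_nat n *s simple_root i = \<Lambda> - root_comb a' b'"
    by (rule weights_below)
  then have "root_comb a' b' = root_comb a b - of_nat n *s simple_root i"
    using \<mu> by (simp add: algebra_simps)
  then show False
    using ab'(1,2) unfolding simple_root_mult_eq root_comb_diff root_comb_inject n_def
    by (auto split: if_splits)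
qed

text \<open>The vectors killed by some power of \<open>f i\<close> form a submodule, because
  bracketing with \<open>f i\<close> is nilpotent on every generator. By irreducibility it suffices
  to find the highest weight vector in it.\<close>

lemma f_locally_nilpotent:
  assumes "\<Lambda> $ Coroot i = of_nat c"
  shows "\<exists>n. (act (f i) ^^ n) u = 0"
proof -
  define N where "N = {u. \<exists>n. (act (f i) ^^ n) u = 0}"
  obtain v where v: "v \<noteq> 0" "v \<in> wspace \<Lambda>" "\<And>i. act (e i) v = 0"
    using highest_weight_vectorE by blast
  have closed: "act y w \<in> N" if "(bracket (f i) ^^ p) y = 0" "w \<in> N" for p y w
    using that act_pow_act_eq_0[OF that(1)] by (auto simp: N_def)
  have N_subspace: "V.subspace N"
  proof (rule V.subspaceI)
    show "0 \<in> N" by (auto simp: N_def)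
    show "scaleV a w \<in> N" if "w \<in> N" for a w
      using that by (auto simp: N_def act_pow_scale)
    show "w + w' \<in> N" if "w \<in> N" "w' \<in> N" for w w'
    proof -
      obtain n n' where "(act (f i) ^^ n) w = 0" "(act (f i) ^^ n') w' = 0"
        using \<open>w \<in> N\<close> \<open>w' \<in> N\<close> by (auto simp: N_def)
      then have "(act (f i) ^^ max n n') (w + w') = 0"
        using act_pow_zero_mono max.cobounded1 max.cobounded2 by (metis act_pow_add add.right_neutral)
      then show ?thesis by (auto simp: N_def)
    qed
  qed
  have ad_h: "(bracket (f i) ^^ 2) (h b) = 0" for b
    using bracket_skew[of "f i" "h b"]
    by (simp add: numeral_2_eq_2 h_f bracket_scale_right bracket_self bracket_minus_right)
  \<comment> \<open>For \<open>k = i\<close> the brackets lead from \<open>e i\<close> to the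
    negative coroot, then to a multiple of \<open>f i\<close>, then to 0.\<close>
  have ad_e: "(bracket (f i) ^^ 3) (e k) = 0" for k
  proof (cases "k = i")
    case True
    have "(bracket (f i) ^^ 2) (bracket (f i) (e i)) = 0"
      using ad_h[of "Coroot i"] bracket_skew[of "f i" "e i"]
      by (simp add: numeral_2_eq_2 e_f bracket_minus_right)
    with True show ?thesis by (simp add: numeral_2_eq_2 numeral_3_eq_3)
  next
    case False
    then show ?thesis using bracket_skew[of "f i" "e k"] by (simp add: numeral_3_eq_3 e_f)
  qed
  have ad_f: "\<exists>p. (bracket (f i) ^^ p) (f k) = 0" for k
  proof (cases "k = i")
    case True
    then show ?thesis by (intro exI[of _ 1]) (simp add: bracket_self)
  qed (use serre_f[of i k] in auto)
  have "submodule N"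
  proof (rule submodule_of_generators[OF N_subspace])
    show "act (f k) w \<in> N" if "w \<in> N" for k w
      using ad_f[of k] closed[OF _ that] by blast
  qed (rule closed[OF ad_h], assumption, rule closed[OF ad_e])
  moreover have "v \<in> N"
  proof -
    \<comment> \<open>This is one step past the end of the \<open>f i\<close>-string of
      \<open>v\<close>. It is singular of a weight different from \<Lambda>, hence zero.\<close>
    define w where "w = (act (f i) ^^ Suc c) v"
    have w: "w \<in> wspace (\<Lambda> - of_nat (Suc c) *s simple_root i)"
      unfolding w_def by (rule f_pow_wspace[OF v(2)])
    have "act (e k) w = 0" for k
    proof (cases "k = i")
      case True
      then show ?thesis
        unfolding w_def using e_f_pow[OF v(2,3), of i c] by (simp add: assms)
    next
      case False
      then show ?thesis unfolding w_def by (subst e_f_pow_other) (auto simp: v(3))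
    qed
    moreover have "\<Lambda> - of_nat (Suc c) *s simple_root i \<noteq> \<Lambda>"
    proof
      assume "\<Lambda> - of_nat (Suc c) *s simple_root i = \<Lambda>"
      then have "of_nat (Suc c) *s simple_root i = root_comb 0 0" by (simp del: of_nat_Suc)
      then show False unfolding simple_root_mult_eq root_comb_inject by (auto split: if_splits)
    qed
    ultimately have "w = 0" using singular_vector_weight[OF w] by blast
    then show ?thesis unfolding N_def w_def by blast
  qed
  ultimately have "N = UNIV"
    using irreducible v(1) unfolding irreducible_module_def by blast
  then show ?thesis by (auto simp: N_def)
qed

text \<open>A reflected weight vector is produced by going to one end of the string through
  \<open>u\<close> and coming back the other way, as far as \<open>sl_2\<close> theory guarantees
  nonzero vectors.\<close>

lemma weights_reflection:
  assumes "\<mu> \<in> weights h scaleV act" and "\<Lambda> $ Coroot i = of_nat c" and z: "\<mu> $ Coroot i = of_int z"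
  shows "\<mu> - of_int z *s simple_root i \<in> weights h scaleV act"
proof -
  obtain u where u: "u \<in> wspace \<mu>" "u \<noteq> 0"
    using assms(1) by (auto simp: weights_def)
  show ?thesis
  proof (cases "0 \<le> z")
    case True
    obtain n where "(act (e i) ^^ n) u = 0"
      using e_locally_nilpotent[OF u(1)] by blast
    from funpow_last_nonzero[OF u(2) this] obtain p
      where p: "(act (e i) ^^ p) u \<noteq> 0" "act (e i) ((act (e i) ^^ p) u) = 0" by auto
    \<comment> \<open>At the top of the string the coroot value is \<open>z + 2 * p\<close>. So
      \<open>z + p\<close> lowering steps keep the vector nonzero, and they end at the reflected
      weight.\<close>
    define w where "w = (act (f i) ^^ (nat z + p)) ((act (e i) ^^ p) u)"
    have ep: "(act (e i) ^^ p) u \<in> wspace (\<mu> + of_nat p *s simple_root i)"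
      by (rule e_pow_wspace[OF u(1)])
    have "w \<noteq> 0"
      unfolding w_def by (rule f_pow_neq_0[OF ep p(2,1), where c = "nat z + 2 * p"]) (use True in \<open>simp_all add: z\<close>)
    moreover have "w \<in> wspace (\<mu> + of_nat p *s simple_root i - of_nat (nat z + p) *s simple_root i)"
      unfolding w_def by (rule f_pow_wspace[OF ep])
    moreover have "\<mu> + of_nat p *s simple_root i - of_nat (nat z + p) *s simple_root i = \<mu> - of_int z *s simple_root i"
      using True by (simp add: vector_sadd_rdistrib)
    ultimately show ?thesis by (auto simp: weights_def)
  next
    case False
    obtain n where "(act (f i) ^^ n) u = 0"
      using f_locally_nilpotent[OF assms(2)] by blast
    from funpow_last_nonzero[OF u(2) this] obtain p
      where p: "(act (f i) ^^ p) u \<noteq> 0" "act (f i) ((act (f i) ^^ p) u) = 0" by auto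
    \<comment> \<open>The mirror image: the bottom of the string has coroot value
      \<open>z - 2 * p\<close>, and \<open>- z + p\<close> raising steps stay within the
      string.\<close>
    define w where "w = (act (e i) ^^ (nat (- z) + p)) ((act (f i) ^^ p) u)"
    have fp: "(act (f i) ^^ p) u \<in> wspace (\<mu> - of_nat p *s simple_root i)"
      by (rule f_pow_wspace[OF u(1)])
    have "w \<noteq> 0"
      unfolding w_def by (rule e_pow_neq_0[OF fp p(2,1), where c = "nat (- z) + 2 * p"]) (use False in \<open>simp_all add: z\<close>)
    moreover have "w \<in> wspace (\<mu> - of_nat p *s simple_root i + of_nat (nat (- z) + p) *s simple_root i)"
      unfolding w_def by (rule e_pow_wspace[OF fp])
    moreover have "\<mu> - of_nat p *s simple_root i + of_nat (nat (- z) + p) *s simple_root i = \<mu> - of_int z *s simple_root i"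
      using False by (simp add: vector_sadd_rdistrib)
    ultimately show ?thesis by (auto simp: weights_def)
  qed
qed

section \<open>Weights as pairs of integers, and explicit weights near the top\<close>

definition occurs :: "int \<Rightarrow> int \<Rightarrow> bool" where
  "occurs a b \<longleftrightarrow> \<Lambda> - root_comb a b \<in> weights h scaleV act"

lemma occurs_nonneg:
  assumes "occurs a b"
  shows "0 \<le> a" "0 \<le> b"
proof -
  have "\<Lambda> - root_comb a b \<in> weights h scaleV act"
    using assms by (simp add: occurs_def)
  then obtain a' b' where "0 \<le> a'" "0 \<le> b'" "\<Lambda> - root_comb a b = \<Lambda> - root_comb a' b'"
    by (rule weights_below)
  moreover from this have "root_comb a b = root_comb a' b'"
    by (metis diff_diff_eq2 diff_add_cancel add_diff_cancel_left')
  ultimately show "0 \<le> a" "0 \<le> b" by simp_all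
qed

lemma weights_occurs: "\<mu> \<in> weights h scaleV act \<longleftrightarrow> (\<exists>a b. \<mu> = \<Lambda> - root_comb a b \<and> occurs a b)"
  by (metis occurs_def weights_below)

lemma occurs_reflection_0:
  assumes "\<Lambda> $ Coroot 0 = of_nat c" and "occurs a b"
  shows "occurs (int c - a + 4 * b) b"
proof -
  have "\<Lambda> - root_comb a b - of_int (int c - 2 * a + 4 * b) *s simple_root 0 \<in> weights h scaleV act"
    using assms by (intro weights_reflection[of _ _ c]) (simp_all add: occurs_def)
  moreover have "of_int (int c - 2 * a + 4 * b) *s simple_root 0 = root_comb (int c - 2 * a + 4 * b) 0"
    by (simp add: root_comb_def)
  ultimately show ?thesis
    by (simp add: occurs_def diff_diff_eq root_comb_add algebra_simps)
qed

lemma occurs_reflection_1: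
  assumes "\<Lambda> $ Coroot 1 = of_nat c" and "occurs a b"
  shows "occurs a (int c + a - b)"
proof -
  have "\<Lambda> - root_comb a b - of_int (int c - 2 * b + a) *s simple_root 1 \<in> weights h scaleV act"
    using assms by (intro weights_reflection[of _ _ c]) (simp_all add: occurs_def)
  moreover have "of_int (int c - 2 * b + a) *s simple_root 1 = root_comb 0 (int c - 2 * b + a)"
    by (simp add: root_comb_def)
  ultimately show ?thesis
    by (simp add: occurs_def diff_diff_eq root_comb_add algebra_simps)
qed

lemma occurs_0_string:
  assumes "\<Lambda> $ Coroot 0 = of_nat c" and "n \<le> c"
  shows "occurs (int n) 0"
proof -
  obtain v where v: "v \<noteq> 0" "v \<in> wspace \<Lambda>" "\<And>i. act (e i) v = 0"
    using highest_weight_vectorE by blast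
  have "(act (f 0) ^^ n) v \<noteq> 0" by (rule f_pow_neq_0[OF v(2,3,1) assms])
  with f_pow_wspace[OF v(2), where i = 0 and n = n] show ?thesis
    unfolding simple_root_mult_eq by (auto simp: occurs_def weights_def)
qed

lemma occurs_1_string:
  assumes "\<Lambda> $ Coroot 1 = of_nat c" and "n \<le> c"
  shows "occurs 0 (int n)"
proof -
  obtain v where v: "v \<noteq> 0" "v \<in> wspace \<Lambda>" "\<And>i. act (e i) v = 0"
    using highest_weight_vectorE by blast
  have "(act (f 1) ^^ n) v \<noteq> 0" by (rule f_pow_neq_0[OF v(2,3,1) assms])
  with f_pow_wspace[OF v(2), where i = 1 and n = n] show ?thesis
    unfolding simple_root_mult_eq by (auto simp: occurs_def weights_def)
qed

text \<open>The vector obtained by lowering \<open>n\<close> times with \<open>f 1\<close> is still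
  killed by \<open>e 0\<close>. Its \<open>Coroot 0\<close> value is \<open>c0 + 4 * n\<close>,
  positive since \<open>0 < n\<close>, so \<open>f 0\<close> does not kill it.\<close>

lemma occurs_1_string_0:
  assumes "\<Lambda> $ Coroot 0 = of_nat c0" "\<Lambda> $ Coroot 1 = of_nat c1" and "n \<le> c1" "0 < n"
  shows "occurs 1 (int n)"
proof -
  obtain v where v: "v \<noteq> 0" "v \<in> wspace \<Lambda>" "\<And>i. act (e i) v = 0"
    using highest_weight_vectorE by blast
  define w where "w = (act (f 1) ^^ n) v"
  have w0: "w \<noteq> 0" unfolding w_def by (rule f_pow_neq_0[OF v(2,3,1) assms(2,3)])
  have w: "w \<in> wspace (\<Lambda> - root_comb 0 (int n))"
    using f_pow_wspace[OF v(2), where i = 1 and n = n] unfolding simple_root_mult_eq by (simp add: w_def)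
  have coroot: "(\<Lambda> - root_comb 0 (int n)) $ Coroot 0 = of_nat (c0 + 4 * n)"
    by (simp add: assms(1))
  have e0: "act (e 0) w = 0"
    unfolding w_def by (subst e_f_pow_other) (simp_all add: v(3))
  have "(act (f 0) ^^ 1) w \<noteq> 0"
    by (rule f_pow_neq_0[OF w e0 w0 coroot]) (use assms(4) in simp)
  moreover have "act (f 0) w \<in> wspace (\<Lambda> - root_comb 1 (int n))"
    using f_wspace[OF w, of 0] unfolding simple_root_eq by (simp add: diff_diff_eq root_comb_add)
  ultimately show ?thesis by (auto simp: occurs_def weights_def)
qed

end

section \<open>The function \<open>\<phi>\<close>\<close>

lemma half_Ints_iff_even: "real_of_int x / 2 \<in> \<int> \<longleftrightarrow> even x"
proof
  assume "real_of_int x / 2 \<in> \<int>"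
  then obtain y where "real_of_int x / 2 = of_int y" by (elim Ints_cases)
  then have "real_of_int x = of_int (2 * y)" by simp
  then have "x = 2 * y" by (simp only: of_int_eq_iff)
  then show "even x" by simp
qed auto

text \<open>The integer is the ceiling of \<open>- x / 2\<close>, that is, the least
  \<open>B\<close> with \<open>0 \<le> x + 2 * B\<close>; this is how it arises as a minimal
  coordinate.\<close>

lemma ceiling_half:
  "real_of_int ((1 - x) div 2) = (if even x then - real_of_int x / 2 else (1 - real_of_int x) / 2)"
proof (cases "even x")
  case True
  then obtain y where "x = 2 * y" by (elim evenE)
  moreover from this have "(1 - x) div 2 = - y" by simp
  ultimately show ?thesis by simp
next
  case False
  then obtain y where "x = 2 * y + 1" by (elim oddE)
  moreover from this have "(1 - x) div 2 = - y" by simp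
  ultimately show ?thesis by simp
qed

text \<open>The shift raises \<open>q\<close> by one and keeps \<open>r\<close>, so only the term
  \<open>- q * (k + r + j)\<close> changes.\<close>

lemma phi_translate:
  assumes "m > 0"
  shows "phi m j (k + real_of_int m / 2) = phi m j k - (2 * k + j + real_of_int m / 2)"
proof -
  have "(k + real_of_int m / 2) / (real_of_int m / 2) = k / (real_of_int m / 2) + 1"
    using assms by (simp add: field_simps)
  then have fl: "\<lfloor>(k + real_of_int m / 2) / (real_of_int m / 2)\<rfloor> = \<lfloor>k / (real_of_int m / 2)\<rfloor> + 1"
    by simp
  define q where "q = \<lfloor>k / (real_of_int m / 2)\<rfloor>"
  define r where "r = k - real_of_int m / 2 * q"
  have r: "k + real_of_int m / 2 - real_of_int m / 2 * real_of_int (q + 1) = r"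
    by (simp add: r_def algebra_simps)
  have k: "k = r + real_of_int m / 2 * q" by (simp add: r_def)
  then show ?thesis
    unfolding phi_def Let_def fl q_def[symmetric] r r_def[symmetric]
    by (simp add: k field_simps)
qed

text \<open>With \<open>K = 2 * k\<close> and \<open>s = K - q * m\<close> in place of
  \<open>2 * r\<close>, the two coset conditions become the parity of \<open>s - m\<close>. Outside
  the first case the interval conditions of the other two hold automatically, so the
  \<open>undefined\<close> branch is never reached.\<close>

lemma phi_eq:
  fixes m j K q :: int
  assumes "m > 0" and "q * m \<le> K" "K < (q + 1) * m"
  shows "phi m j (K / 2) = - q * (K - q * m / 2 + j) +
    (if K - q * m \<le> m - 2 * j then - (K - q * m) / 2
     else if even (K - q * m - m) then m / 2 - j - (K - q * m)
     else (m - 1) / 2 - j - (K - q * m))"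
proof -
  have fl: "\<lfloor>real_of_int K / 2 / (real_of_int m / 2)\<rfloor> = q"
  proof (rule floor_unique)
    have "real_of_int (q * m) \<le> K" "real_of_int K < of_int ((q + 1) * m)"
      using assms by (simp_all only: of_int_le_iff of_int_less_iff)
    then show "real_of_int q \<le> real_of_int K / 2 / (real_of_int m / 2)"
      "real_of_int K / 2 / (real_of_int m / 2) < of_int q + 1"
      using assms(1) by (simp_all add: field_simps)
  qed
  define s where "s = K - q * m"
  have s: "0 \<le> s" "s < m" using assms by (auto simp: s_def algebra_simps)
  have r: "real_of_int K / 2 - real_of_int m / 2 * real_of_int q = of_int s / 2"
    by (simp add: s_def algebra_simps)
  have K: "real_of_int K = of_int s + of_int q * of_int m" by (simp add: s_def)
  have "real_of_int s / 2 - real_of_int m / 2 = of_int (s - m) / 2"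
    by (simp add: field_simps)
  then have even: "real_of_int s / 2 - real_of_int m / 2 \<in> \<int> \<longleftrightarrow> even (s - m)"
    by (simp only: half_Ints_iff_even)
  have "real_of_int s / 2 - (real_of_int m - 1) / 2 = of_int (s - m + 1) / 2"
    by (simp add: field_simps)
  then have odd: "real_of_int s / 2 - (real_of_int m - 1) / 2 \<in> \<int> \<longleftrightarrow> odd (s - m)"
    by (simp only: half_Ints_iff_even) simp
  have first: "real_of_int s / 2 \<in> {0..real_of_int m / 2 - j} \<longleftrightarrow> s \<le> m - 2 * j"
    using s by auto
  have second: "real_of_int s / 2 \<in> {real_of_int m / 2 - j..<real_of_int m / 2}" if "\<not> s \<le> m - 2 * j"
    using s that by auto
  have third: "real_of_int s / 2 \<in> {(real_of_int m - 1) / 2 - j..<real_of_int m / 2}" if "\<not> s \<le> m - 2 * j"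
    using s that by (auto simp: field_simps)
  show ?thesis
    unfolding phi_def Let_def fl r even odd first s_def[symmetric]
    using second third by (auto simp: K field_simps)
qed

text \<open>In the coordinates \<open>K = 2 k\<close> and \<open>B\<close>, the weight \<open>\<Lambda> - (K + 2 B) \<alpha>\<^sub>0 - B \<alpha>\<^sub>1\<close>
  lies on the \<open>\<delta>\<close>-line of \<open>\<Lambda> + k \<alpha>\<close>, and adding \<open>\<delta>\<close> decreases \<open>B\<close> by 1.\<close>

lemma phi_minimal:
  fixes m j K :: int and P :: "int \<Rightarrow> int \<Rightarrow> bool"
  assumes m: "m > 0" and j: "0 \<le> j" "2 * j \<le> m"
    and nonneg: "\<And>K B. P K B \<Longrightarrow> 0 \<le> B \<and> 0 \<le> K + 2 * B"
    and refl0: "\<And>K B. P K B \<Longrightarrow> P (m - 2 * j - K) B"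
    and refl1: "\<And>K B. P K B \<Longrightarrow> P (- 2 * j - K) (j + K + B)"
    and base0: "\<And>K. 0 \<le> K \<Longrightarrow> K \<le> m - 2 * j \<Longrightarrow> P K 0"
    and base1: "\<And>b. 0 \<le> b \<Longrightarrow> b \<le> j \<Longrightarrow> P (- 2 * b) b"
    and base2: "\<And>b. 0 < b \<Longrightarrow> b \<le> j \<Longrightarrow> P (1 - 2 * b) b"
  shows "\<exists>B. P K B \<and> (\<forall>B'. P K B' \<longrightarrow> B \<le> B') \<and> phi m j (K / 2) = - real_of_int K / 2 - B"
proof -
  define S where "S K B \<longleftrightarrow> P K B \<and> (\<forall>B'. P K B' \<longrightarrow> B \<le> B')" for K B
  \<comment> \<open>The reflections are involutions, and the change they make in \<open>B\<close>
    depends only on \<open>K\<close>; hence they carry least elements to least elements.\<close>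
  have S_refl0: "S (m - 2 * j - K) B" if "S K B" for K B
    using that refl0[of K B] refl0[of "m - 2 * j - K"] by (auto simp: S_def)
  have S_refl1: "S (- 2 * j - K) (j + K + B)" if "S K B" for K B
    using that refl1[of K B] refl1[of "- 2 * j - K"] by (force simp: S_def)
  have S_trans: "S (K + m) (j + K + B)" if "S K B" for K B
    using S_refl0[OF S_refl1[OF that]] by (simp add: algebra_simps)
  have S_trans': "S (K - m) (B - j - K + m)" if "S K B" for K B
    using S_refl1[OF S_refl0[OF that]] by (simp add: algebra_simps)
  \<comment> \<open>For negative \<open>K\<close> the binding constraint is
    \<open>0 \<le> K + 2 * B\<close>, whose least solution is the ceiling of \<open>- K / 2\<close>.
    It is attained with \<open>K + 2 * B\<close> equal to 0 for even \<open>K\<close> and 1 for odd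
    \<open>K\<close>, the cases \<open>base1\<close> and \<open>base2\<close>.\<close>
  have S_neg: "S K ((1 - K) div 2)" if "- j \<le> K" "K < 0" for K
  proof (cases "even K")
    case True
    then obtain b where "K = 2 * b" by (elim evenE)
    then have K: "K = - 2 * (- b)" "(1 - K) div 2 = - b" by auto
    then have "P K (- b)" using that base1[of "- b"] by simp
    moreover have "- b \<le> B" if "P K B" for B using nonneg[OF that] K by simp
    ultimately show ?thesis by (simp add: S_def K(2))
  next
    case False
    then obtain b where "K = 2 * b + 1" by (elim oddE)
    then have K: "K = 1 - 2 * (- b)" "(1 - K) div 2 = - b" by auto
    then have "P K (- b)" using that base2[of "- b"] by simp
    moreover have "- b \<le> B" if "P K B" for B using nonneg[OF that] K by simp
    ultimately show ?thesis by (simp add: S_def K(2))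
  qed
  define T where "T K \<longleftrightarrow> (\<exists>B. S K B \<and> phi m j (real_of_int K / 2) = - real_of_int K / 2 - real_of_int B)" for K
  \<comment> \<open>One full period of the translation by \<open>m\<close>: the dominant range of
    \<open>K\<close> together with its image under the first reflection.\<close>
  have window: "T K" if K: "- j \<le> K" "K < m - j" for K
  proof -
    consider "K < 0" | "0 \<le> K" "K \<le> m - 2 * j" | "m - 2 * j < K" by linarith
    then show ?thesis
    proof cases
      case 1
      then have "phi m j (real_of_int K / 2) = - real_of_int K / 2 - real_of_int ((1 - K) div 2)"
        \<comment> \<open>A negative \<open>K\<close> has quotient -1. Here \<open>K + m\<close>
          exceeds \<open>m - 2 * j\<close>, so the parity cases of the formula apply.\<close>
        using K j phi_eq[of m "-1" K j] m by (simp add: ceiling_half field_simps)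
      with S_neg[OF K(1) 1] show ?thesis by (auto simp: T_def)
    next
      case 2
      then have "S K 0" using base0 nonneg by (auto simp: S_def)
      moreover have "phi m j (real_of_int K / 2) = - real_of_int K / 2 - real_of_int 0"
        using phi_eq[of m 0 K j] m 2 j K by simp
      ultimately show ?thesis unfolding T_def by blast
    next
      case 3
      \<comment> \<open>The first reflection carries this range to negative values and keeps
        \<open>B\<close>.\<close>
      have "S K ((1 - (m - 2 * j - K)) div 2)"
        using S_refl0[OF S_neg[of "m - 2 * j - K"]] K 3 by simp
      moreover have "real_of_int ((1 - (m - 2 * j - K)) div 2) =
          (if even (K - m) then - real_of_int (m - 2 * j - K) / 2 else (1 - real_of_int (m - 2 * j - K)) / 2)"
        unfolding ceiling_half by simp
      then have "phi m j (real_of_int K / 2) = - real_of_int K / 2 - real_of_int ((1 - (m - 2 * j - K)) div 2)"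
        using phi_eq[of m 0 K j] m 3 j K by (simp add: field_simps)
      ultimately show ?thesis unfolding T_def by blast
    qed
  qed
  have up: "T (K + m)" if TK: "T K" for K
  proof -
    obtain B where B: "S K B" "phi m j (K / 2) = - K / 2 - B"
      using TK by (auto simp: T_def)
    have "phi m j ((K + m) / 2) = - (K + m) / 2 - (j + K + B)"
      using phi_translate[OF m, of j "K / 2"] B(2) by (simp add: field_simps)
    with S_trans[OF B(1)] show ?thesis unfolding T_def by (intro exI[of _ "j + K + B"]) simp
  qed
  have down: "T (K - m)" if TK: "T K" for K
  proof -
    obtain B where B: "S K B" "phi m j (K / 2) = - K / 2 - B"
      using TK by (auto simp: T_def)
    \<comment> \<open>The translation formula is used at \<open>(K - m) / 2\<close> and read
      backwards.\<close>
    have "phi m j ((K - m) / 2) = - (K - m) / 2 - (B - j - K + m)"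
      using phi_translate[OF m, of j "(K - m) / 2"] B(2) by (simp add: field_simps)
    with S_trans'[OF B(1)] show ?thesis unfolding T_def by (intro exI[of _ "B - j - K + m"]) simp
  qed
  \<comment> \<open>The representative of \<open>K\<close> modulo \<open>m\<close> in the period
    from \<open>- j\<close> up to, but excluding, \<open>m - j\<close>.\<close>
  define K0 where "K0 = (K + j) mod m - j"
  have K: "K = K0 + (K + j) div m * m" by (simp add: K0_def algebra_simps)
  have "T K0" using m by (intro window) (simp_all add: K0_def)
  then have "T (K0 + q * m)" for q
  proof (induction q rule: int_induct[where k = 0])
    case (step1 q)
    then show ?case using up[of "K0 + q * m"] by (simp add: algebra_simps)
  next
    case (step2 q)
    then show ?case using down[of "K0 + q * m"] by (simp add: algebra_simps)
  qed simp
  then have "T K" using K by metis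
  then show ?thesis by (simp add: T_def S_def)
qed

section \<open>Maximal weights\<close>

lemma alpha_eq: "alpha = root_comb 0 1"
  by (simp add: alpha_def root_comb_def)

lemma delta_eq: "delta = root_comb 2 1"
  by (simp add: delta_def root_comb_def)

lemma delta_line_eq:
  "\<Lambda> + complex_of_real (real_of_int K / 2) *s alpha
      + complex_of_real (- real_of_int K / 2 - real_of_int B) *s delta
    = \<Lambda> - root_comb (K + 2 * B) B"
  by (simp add: weight_eq_iff alpha_eq delta_eq field_simps)

lemma Lambda0_nth [simp]:
  "Lambda0 $ Coroot 0 = 1" "Lambda0 $ Coroot 1 = 0" "Lambda0 $ Deriv = 0"
  by (simp_all add: Lambda0_def)

lemma alpha_delta_inject:
  "\<nu> + a *s alpha + b *s delta = \<nu> + a' *s alpha + b' *s delta \<longleftrightarrow> a = a' \<and> b = b'"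
  by (auto simp: weight_eq_iff alpha_eq delta_eq)

context A22_irreducible_highest_weight_module
begin

text \<open>In the coordinates \<open>K\<close> and \<open>B\<close> the \<delta>-lines are the sets
  of constant \<open>K\<close>, and maximality on a line means that \<open>B\<close> is
  least.\<close>

lemma max_weights_occurs:
  "max_weights h scaleV act =
    {\<Lambda> - root_comb (K + 2 * B) B | K B. occurs (K + 2 * B) B \<and> (\<forall>B'. occurs (K + 2 * B') B' \<longrightarrow> B \<le> B')}"
    (is "_ = ?R")
proof -
  have shift: "\<Lambda> - root_comb (K + 2 * B) B + of_int n *s delta = \<Lambda> - root_comb (K + 2 * (B - n)) (B - n)" for K B n
    by (simp add: weight_eq_iff delta_eq algebra_simps)
  have max: "\<Lambda> - root_comb (K + 2 * B) B \<in> max_weights h scaleV act \<longleftrightarrow>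
      occurs (K + 2 * B) B \<and> (\<forall>B'. occurs (K + 2 * B') B' \<longrightarrow> B \<le> B')" for K B
  proof -
    have "(\<forall>n. n > 0 \<longrightarrow> \<not> occurs (K + 2 * (B - n)) (B - n)) \<longleftrightarrow> (\<forall>B'. occurs (K + 2 * B') B' \<longrightarrow> B \<le> B')"
    proof (intro iffI allI impI notI)
      fix B' assume "\<forall>n. n > 0 \<longrightarrow> \<not> occurs (K + 2 * (B - n)) (B - n)" "occurs (K + 2 * B') B'"
      then show "B \<le> B'" by (auto dest: spec[of _ "B - B'"])
    next
      fix n :: int
      assume "\<forall>B'. occurs (K + 2 * B') B' \<longrightarrow> B \<le> B'" "n > 0" "occurs (K + 2 * (B - n)) (B - n)"
      then have "B \<le> B - n" by blast
      with \<open>n > 0\<close> show False by simp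
    qed
    then show ?thesis unfolding max_weights_def mem_Collect_eq shift occurs_def by blast
  qed
  show ?thesis
  proof (intro set_eqI iffI)
    fix \<mu> assume \<mu>: "\<mu> \<in> max_weights h scaleV act"
    then obtain a b where ab: "\<mu> = \<Lambda> - root_comb a b"
      unfolding max_weights_def weights_occurs by blast
    then have "\<mu> = \<Lambda> - root_comb ((a - 2 * b) + 2 * b) b" by simp
    with \<mu> max show "\<mu> \<in> ?R" by blast
  qed (use max in blast)
qed

lemma max_weights_eq:
  fixes m j :: int
  assumes "m > 0" "0 \<le> j" "2 * j \<le> m" and \<Lambda>: "\<Lambda> = of_int m *s Lambda0 + (of_int j / 2) *s alpha"
  shows "max_weights h scaleV act =
    {\<Lambda> + complex_of_real k *s alpha + complex_of_real (phi m j k) *s delta | k. 2 * k \<in> \<int>}"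
proof -
  have coroot0: "\<Lambda> $ Coroot 0 = of_nat (nat (m - 2 * j))" and coroot1: "\<Lambda> $ Coroot 1 = of_nat (nat j)"
    using assms(2,3) by (simp_all add: \<Lambda> alpha_eq)
  let ?min = "\<lambda>K B. occurs (K + 2 * B) B \<and> (\<forall>B'. occurs (K + 2 * B') B' \<longrightarrow> B \<le> B')"
  have minimal: "\<exists>B. ?min K B \<and> phi m j (K / 2) = - real_of_int K / 2 - B" for K
    unfolding conj_assoc
  proof (rule phi_minimal[OF assms(1-3), where P = "\<lambda>K B. occurs (K + 2 * B) B"])
    show "0 \<le> B \<and> 0 \<le> K + 2 * B" if "occurs (K + 2 * B) B" for K B
      using occurs_nonneg[OF that] by simp
    show "occurs (m - 2 * j - K + 2 * B) B" if "occurs (K + 2 * B) B" for K B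
      using occurs_reflection_0[OF coroot0 that] assms(3) by (simp add: algebra_simps)
    show "occurs (- 2 * j - K + 2 * (j + K + B)) (j + K + B)" if "occurs (K + 2 * B) B" for K B
      using occurs_reflection_1[OF coroot1 that] assms(2) by (simp add: algebra_simps)
    show "occurs (K + 2 * 0) 0" if "0 \<le> K" "K \<le> m - 2 * j" for K
      using occurs_0_string[OF coroot0, of "nat K"] that by simp
    show "occurs (- 2 * b + 2 * b) b" if "0 \<le> b" "b \<le> j" for b
      using occurs_1_string[OF coroot1, of "nat b"] that by simp
    show "occurs (1 - 2 * b + 2 * b) b" if "0 < b" "b \<le> j" for b
      using occurs_1_string_0[OF coroot0 coroot1, of "nat b"] that by simp
  qed
  have line: "\<Lambda> + complex_of_real (K / 2) *s alpha + complex_of_real (phi m j (K / 2)) *s delta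
      = \<Lambda> - root_comb (K + 2 * B) B" if "?min K B" for K B :: int
  proof -
    obtain B' where B': "?min K B'" "phi m j (K / 2) = - real_of_int K / 2 - B'" using minimal[of K] by auto
    \<comment> \<open>A least element is unique, so the \<open>B\<close> at hand is the one given by
      \<phi>.\<close>
    then have "B' = B" using that by (meson order_antisym)
    with B'(2) show ?thesis using delta_line_eq[of \<Lambda> K B] by simp
  qed
  show ?thesis unfolding max_weights_occurs
  proof (intro set_eqI iffI)
    fix \<mu> assume "\<mu> \<in> {\<Lambda> - root_comb (K + 2 * B) B | K B. ?min K B}"
    then obtain K B where "?min K B" "\<mu> = \<Lambda> - root_comb (K + 2 * B) B" by blast
    then show "\<mu> \<in> {\<Lambda> + complex_of_real k *s alpha + complex_of_real (phi m j k) *s delta | k. 2 * k \<in> \<int>}"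
      using line[of K B] by (auto intro!: exI[of _ "real_of_int K / 2"])
  next
    fix \<mu> assume "\<mu> \<in> {\<Lambda> + complex_of_real k *s alpha + complex_of_real (phi m j k) *s delta | k. 2 * k \<in> \<int>}"
    then obtain k where k: "2 * k \<in> \<int>"
      "\<mu> = \<Lambda> + complex_of_real k *s alpha + complex_of_real (phi m j k) *s delta" by blast
    then obtain K where "2 * k = real_of_int K" by (elim Ints_cases)
    then have K: "k = real_of_int K / 2" by simp
    obtain B where "?min K B" using minimal[of K] by blast
    with line[of K B] show "\<mu> \<in> {\<Lambda> - root_comb (K + 2 * B) B | K B. ?min K B}"
      unfolding k(2) K by blast
  qed
qed

end

theorem proposition5p7:
  fixes m j :: int
    and scale :: "complex \<Rightarrow> 'g::ab_group_add \<Rightarrow> 'g"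
    and bracket :: "'g \<Rightarrow> 'g \<Rightarrow> 'g"
    and h :: "cartan_basis \<Rightarrow> 'g"
    and e f :: "2 \<Rightarrow> 'g"
    and scaleV :: "complex \<Rightarrow> 'v::ab_group_add \<Rightarrow> 'v"
    and act :: "'g \<Rightarrow> 'v \<Rightarrow> 'v"
    and \<Lambda> :: weight
  assumes "m > 0" and "0 \<le> j" and "real_of_int j \<le> real_of_int m / 2"
    and "\<Lambda> = of_int m *s Lambda0 + (of_int j / 2) *s alpha"
    and "A22_irreducible_highest_weight_module scale bracket h e f scaleV act \<Lambda>"
  shows "max_weights h scaleV act =
           {\<Lambda> + complex_of_real k *s alpha + complex_of_real (phi m j k) *s delta | k. 2 * k \<in> \<int>} \<and>
         (\<forall>j' :: int. \<forall>\<mu>. \<mu> = of_int m *s Lambda0 + (of_int j' / 2) *s alpha \<longrightarrow>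
            \<mu> \<in> {\<nu> + c *s delta | \<nu> c. \<nu> \<in> weights h scaleV act} \<and>
            max_shift h scaleV act \<mu> = complex_of_real (phi m j ((real_of_int j' - real_of_int j) / 2)))"
proof -
  interpret A22_irreducible_highest_weight_module scale bracket h e f scaleV act \<Lambda> by fact
  have "2 * j \<le> m" using assms(3) by linarith
  note max = max_weights_eq[OF assms(1,2) this assms(4)]
  have "\<mu> \<in> {\<nu> + c *s delta | \<nu> c. \<nu> \<in> weights h scaleV act} \<and>
      max_shift h scaleV act \<mu> = complex_of_real (phi m j ((real_of_int j' - real_of_int j) / 2))"
    if \<mu>: "\<mu> = of_int m *s Lambda0 + (of_int j' / 2) *s alpha" for j' :: int and \<mu>
  proof -
    \<comment> \<open>The coefficient of \<alpha> in \<open>\<mu> - \<Lambda>\<close>.\<close>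
    define k where "k = (real_of_int j' - real_of_int j) / 2"
    define b where "b = complex_of_real (phi m j k)"
    have \<mu>k: "\<mu> = \<Lambda> + complex_of_real k *s alpha"
      by (simp add: \<mu> assms(4) k_def weight_eq_iff alpha_eq field_simps)
    have "2 * k = real_of_int (j' - j)" by (simp add: k_def)
    then have "2 * k \<in> \<int>" by (metis Ints_of_int)
    then have mem: "\<mu> + b *s delta \<in> max_weights h scaleV act"
      unfolding max \<mu>k b_def by blast
    \<comment> \<open>Independence of \<open>alpha\<close> and \<open>delta\<close> forces any
      maximal weight on this line to come from the same \<open>k\<close>; this is the uniqueness
      required by \<open>THE\<close>.\<close>
    have "c = b" if "\<mu> + c *s delta \<in> max_weights h scaleV act" for c
      using that unfolding max \<mu>k b_def by (auto simp: alpha_delta_inject)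
    with mem have "max_shift h scaleV act \<mu> = b"
      unfolding max_shift_def by (rule the_equality)
    moreover have "\<mu> = (\<mu> + b *s delta) + (- b) *s delta"
      by (simp add: weight_eq_iff)
    moreover have "\<mu> + b *s delta \<in> weights h scaleV act"
      using mem by (simp add: max_weights_def)
    ultimately show ?thesis unfolding b_def k_def by blast
  qed
  with max show ?thesis by blast
qed

end
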